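(* Let $\mathcal P$ be a Markov kernel on a Polish space $\mathbf X$, and let $V:\mathbf X\to[0,\infty)$ be a continuous Lyapunov function of $\mathcal P$, i.e. there are $\gamma\in(0,1)$ and $K>0$ with $(\mathcal PV)(x)\le\gamma V(x)+K$ for all $x\in\mathbf X$. Let $d:\mathbf X\times\mathbf X\to[0,1]$ be a distance-like function such that: (i) there exists $\bar\alpha_0\in(0,1)$ with $d(\delta_x\mathcal P,\delta_y\mathcal P)\le\bar\alpha_0\, d(x,y)$ for every $x,y$ such that $d(x,y)<1$; (ii) for every $R>0$ there is $\alpha\in(0,1)$ (depending on $R$) such that $\sup_{x,y\in\mathcal S(R)}d(\delta_x\mathcal P,\delta_y\mathcal P)<1-\alpha$, where $\mathcal S(R)=\{x:V(x)<R\}$. Then there exist $\bar\alpha\in(0,1)$ and $\beta>0$ such that for all $x,y\in\mathbf X$, $$\tilde d_\beta(\delta_x\mathcal P,\delta_y\mathcal P)\le\bar\alpha\,\tilde d_\beta(x,y).$$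
   Context: $\delta_x\mathcal P=\mathcal P(x,\cdot)$ and $(\mathcal PV)(x)=\int V(y)\,\mathcal P(x,dy)$. A function $d:\mathbf X\times\mathbf X\to\mathbb R_+$ is distance-like if it is symmetric, lower semicontinuous, and $d(x,y)=0\Leftrightarrow x=y$ (no triangle inequality is required). For a distance-like $d$ and probability measures $\mu,\nu$, $d(\mu,\nu)=\inf_{\Gamma}\int_{\mathbf X\times\mathbf X}d(x,y)\,\Gamma(dx,dy)$, the infimum over all couplings $\Gamma$ of $\mu$ and $\nu$. For $\beta>0$, $\tilde d_\beta(x,y)=\sqrt{d(x,y)\,(2+\beta V(x)+\beta V(y))}$, and $\tilde d_\beta(\mu,\nu)$ is defined from $\tilde d_\beta(x,y)$ by the same infimum over couplings. *)

theory Defs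
  imports "HOL-Probability.Probability"
begin

definition lower_semicontinuous :: "('a::topological_space \<Rightarrow> real) \<Rightarrow> bool" where
  "lower_semicontinuous f \<longleftrightarrow> (\<forall>z. \<forall>a < f z. eventually (\<lambda>w. a < f w) (nhds z))"

definition distance_like :: "('a::topological_space \<Rightarrow> 'a \<Rightarrow> real) \<Rightarrow> bool" where
  "distance_like d \<longleftrightarrow>
     (\<forall>x y. 0 \<le> d x y) \<and>
     (\<forall>x y. d x y = d y x) \<and>
     lower_semicontinuous (\<lambda>(x, y). d x y) \<and>
     (\<forall>x y. d x y = 0 \<longleftrightarrow> x = y)"

definition couplings ::
    "'a::topological_space measure \<Rightarrow> 'a measure \<Rightarrow> ('a \<times> 'a) measure set" where
  "couplings \<mu> \<nu> = {\<Gamma> \<in> space (prob_algebra (borel \<Otimes>\<^sub>M borel)).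
     distr \<Gamma> borel fst = \<mu> \<and> distr \<Gamma> borel snd = \<nu>}"

text \<open>The extension of a distance-like function to probability measures. It is valued in
  \<^typ>\<open>ennreal\<close> because it may be infinite when \<open>d\<close> is unbounded.\<close>

definition coupling_dist ::
    "('a::topological_space \<Rightarrow> 'a \<Rightarrow> real) \<Rightarrow> 'a measure \<Rightarrow> 'a measure \<Rightarrow> ennreal" where
  "coupling_dist d \<mu> \<nu> = (INF \<Gamma> \<in> couplings \<mu> \<nu>. \<integral>\<^sup>+ (x, y). ennreal (d x y) \<partial>\<Gamma>)"

definition markov_kernel :: "('a::topological_space \<Rightarrow> 'a measure) \<Rightarrow> bool" where
  "markov_kernel P \<longleftrightarrow> P \<in> borel \<rightarrow>\<^sub>M prob_algebra borel"

text \<open>The drift condition uses the nonnegative Lebesgue integral, so that it also asserts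
  that \<open>V\<close> is integrable with respect to every \<open>P x\<close>.\<close>

definition lyapunov_function :: "('a::topological_space \<Rightarrow> 'a measure) \<Rightarrow> ('a \<Rightarrow> real) \<Rightarrow> bool" where
  "lyapunov_function P V \<longleftrightarrow>
     (\<forall>x. 0 \<le> V x) \<and>
     (\<exists>\<gamma> K. 0 < \<gamma> \<and> \<gamma> < 1 \<and> 0 < K \<and>
        (\<forall>x. (\<integral>\<^sup>+ y. ennreal (V y) \<partial>P x) \<le> ennreal (\<gamma> * V x + K)))"

definition weighted_dist ::
    "real \<Rightarrow> ('a \<Rightarrow> real) \<Rightarrow> ('a \<Rightarrow> 'a \<Rightarrow> real) \<Rightarrow> 'a \<Rightarrow> 'a \<Rightarrow> real" where
  "weighted_dist \<beta> V d x y = sqrt (d x y * (2 + \<beta> * V x + \<beta> * V y))"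

definition sublevel :: "('a \<Rightarrow> real) \<Rightarrow> real \<Rightarrow> 'a set" where
  "sublevel V R = {x. V x < R}"

end

theory Submission
  imports Defs
begin

text \<open>
  Write \<open>D\<close> for the coupling distance of \<open>d\<close> and \<open>D\<^sub>\<beta>\<close> for that of the weighted function. Applying the
  Cauchy--Schwarz inequality under each coupling of \<open>P x\<close> and \<open>P y\<close> separates \<open>d\<close> from the weight, and
  the integral of the weight is the same under all couplings, since it only sees the marginals.
  With the drift condition and \<open>S = V x + V y\<close> this gives
  \<open>D\<^sub>\<beta> (P x) (P y)\<^sup>2 \<le> D (P x) (P y) * (2 + \<beta> * (\<gamma> * S + 2 * K))\<close>
  (lemma \<open>coupling_dist_weighted_dist_square_le\<close>), to be compared with \<open>d x y * (2 + \<beta> * S)\<close>.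

  Drifting can enlarge the weight by a factor of at most \<open>1 + \<beta> * K\<close>, and shrinks it by a fixed factor once \<open>S\<close> is at least
  \<open>L = 4 * K / (1 - \<gamma>)\<close>. If \<open>d x y < 1\<close>, or if \<open>d x y = 1\<close> and \<open>S < L\<close>, then \<open>D (P x) (P y)\<close> is at most
  \<open>\<theta> * d x y\<close> for a fixed \<open>\<theta> < 1\<close>, and a small \<open>\<beta>\<close> keeps \<open>\<theta> * (1 + \<beta> * K)\<close> below \<open>1\<close>. If \<open>d x y = 1\<close> and
  \<open>S \<ge> L\<close>, the factor \<open>D (P x) (P y) \<le> 1\<close> yields no gain, but the weight contracts. Lemma
  \<open>drift_weight_contraction\<close> makes one choice of \<open>\<beta>\<close> and of the rate serve both situations.
\<close>

lemma borel_measurable_lower_semicontinuous: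
  assumes "lower_semicontinuous f"
  shows "f \<in> borel_measurable borel"
proof -
  have "open {z. a < f z}" for a
  proof (subst open_subopen, rule ballI)
    fix z assume "z \<in> {z. a < f z}"
    then have "eventually (\<lambda>w. a < f w) (nhds z)"
      using assms by (simp add: lower_semicontinuous_def)
    then show "\<exists>T. open T \<and> z \<in> T \<and> T \<subseteq> {z. a < f z}"
      unfolding eventually_nhds by (metis mem_Collect_eq subsetI)
  qed
  then show ?thesis
    by (subst borel_measurable_iff_greater) auto
qed

lemma power2_le_imp_le_ennreal:
  fixes a b :: ennreal
  assumes "a\<^sup>2 \<le> b\<^sup>2"
  shows "a \<le> b"
  using assms
  by (cases a; cases b)
    (auto simp: ennreal_power power_eq_top_ennreal top_unique intro: power2_le_imp_le)

lemma nn_integral_coupling_fst_snd: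
  assumes "\<Gamma> \<in> couplings \<mu> \<nu>" and f [measurable]: "f \<in> borel_measurable borel"
  shows "(\<integral>\<^sup>+ z. f (fst z) \<partial>\<Gamma>) = (\<integral>\<^sup>+ x. f x \<partial>\<mu>)"
    and "(\<integral>\<^sup>+ z. f (snd z) \<partial>\<Gamma>) = (\<integral>\<^sup>+ x. f x \<partial>\<nu>)"
proof -
  have sets [measurable_cong]: "sets \<Gamma> = sets (borel \<Otimes>\<^sub>M borel)"
    and marg: "distr \<Gamma> borel fst = \<mu>" "distr \<Gamma> borel snd = \<nu>"
    using assms(1) by (auto simp: couplings_def space_prob_algebra)
  show "(\<integral>\<^sup>+ z. f (fst z) \<partial>\<Gamma>) = (\<integral>\<^sup>+ x. f x \<partial>\<mu>)"
    unfolding marg(1)[symmetric] by (subst nn_integral_distr) auto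
  show "(\<integral>\<^sup>+ z. f (snd z) \<partial>\<Gamma>) = (\<integral>\<^sup>+ x. f x \<partial>\<nu>)"
    unfolding marg(2)[symmetric] by (subst nn_integral_distr) auto
qed

text \<open>
  Cauchy--Schwarz for \<open>sqrt d * sqrt w\<close>, where \<open>w\<close> is the weight. The second factor does not depend on
  the coupling, so the bound survives the infimum over couplings.
\<close>

lemma coupling_dist_weighted_dist_square_le:
  fixes \<mu> \<nu> :: "'a::polish_space measure"
  assumes d: "lower_semicontinuous (\<lambda>(x, y). d x y)" "\<And>x y. 0 \<le> d x y"
    and V [measurable]: "V \<in> borel_measurable borel" and V0: "\<And>x. 0 \<le> V x"
    and \<beta>: "0 \<le> \<beta>" and ab: "0 \<le> a" "0 \<le> b"
    and a: "(\<integral>\<^sup>+ x. ennreal (V x) \<partial>\<mu>) \<le> ennreal a"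
    and b: "(\<integral>\<^sup>+ x. ennreal (V x) \<partial>\<nu>) \<le> ennreal b"
  shows "(coupling_dist (weighted_dist \<beta> V d) \<mu> \<nu>)\<^sup>2
           \<le> coupling_dist d \<mu> \<nu> * ennreal (2 + \<beta> * (a + b))"
proof -
  define A where "A = coupling_dist (weighted_dist \<beta> V d) \<mu> \<nu>"
  define c where "c = 2 + \<beta> * (a + b)"
  have c: "0 < c"
    using \<beta> ab by (simp add: c_def add_pos_nonneg)
  have bound: "A\<^sup>2 \<le> (\<integral>\<^sup>+ (x, y). ennreal (d x y) \<partial>\<Gamma>) * ennreal c" if \<Gamma>: "\<Gamma> \<in> couplings \<mu> \<nu>" for \<Gamma>
  proof -
    have sets [measurable_cong]: "sets \<Gamma> = sets (borel \<Otimes>\<^sub>M borel)" and "prob_space \<Gamma>"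
      using \<Gamma> by (auto simp: couplings_def space_prob_algebra)
    interpret prob_space \<Gamma> by fact
    have d_meas [measurable]: "(\<lambda>z. d (fst z) (snd z)) \<in> borel_measurable (borel \<Otimes>\<^sub>M borel)"
      using borel_measurable_lower_semicontinuous[OF d(1)]
      by (simp add: borel_prod case_prod_unfold)
    define w where "w z = 2 + \<beta> * V (fst z) + \<beta> * V (snd z)" for z :: "'a \<times> 'a"
    have w_meas [measurable]: "w \<in> borel_measurable (borel \<Otimes>\<^sub>M borel)"
      unfolding w_def by measurable
    have w0: "0 \<le> w z" for z
      using V0 \<beta> by (simp add: w_def)
    have "(\<integral>\<^sup>+ z. ennreal (w z) \<partial>\<Gamma>)
        = (\<integral>\<^sup>+ z. 2 + ennreal \<beta> * ennreal (V (fst z)) + ennreal \<beta> * ennreal (V (snd z)) \<partial>\<Gamma>)"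
      using V0 \<beta> by (simp add: w_def ennreal_plus ennreal_mult)
    also have "\<dots> = 2 + ennreal \<beta> * (\<integral>\<^sup>+ z. ennreal (V (fst z)) \<partial>\<Gamma>)
                     + ennreal \<beta> * (\<integral>\<^sup>+ z. ennreal (V (snd z)) \<partial>\<Gamma>)"
      by (simp add: nn_integral_add nn_integral_cmult emeasure_space_1)
    also have "\<dots> = 2 + ennreal \<beta> * (\<integral>\<^sup>+ x. ennreal (V x) \<partial>\<mu>) + ennreal \<beta> * (\<integral>\<^sup>+ x. ennreal (V x) \<partial>\<nu>)"
      using nn_integral_coupling_fst_snd[OF \<Gamma>, of "\<lambda>x. ennreal (V x)"] by simp
    also have "\<dots> \<le> 2 + ennreal \<beta> * ennreal a + ennreal \<beta> * ennreal b"
      using a b by (intro add_mono mult_left_mono) auto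
    also have "\<dots> = ennreal c"
      using \<beta> ab by (simp add: c_def ennreal_plus ennreal_mult distrib_left add.assoc)
    finally have w_int: "(\<integral>\<^sup>+ z. ennreal (w z) \<partial>\<Gamma>) \<le> ennreal c" .
    have "A \<le> (\<integral>\<^sup>+ (x, y). ennreal (weighted_dist \<beta> V d x y) \<partial>\<Gamma>)"
      unfolding A_def coupling_dist_def using \<Gamma> by (rule INF_lower)
    also have "\<dots> = (\<integral>\<^sup>+ z. ennreal (sqrt (d (fst z) (snd z))) * ennreal (sqrt (w z)) \<partial>\<Gamma>)"
      using d(2) w0
      by (simp add: weighted_dist_def w_def case_prod_unfold real_sqrt_mult ennreal_mult)
    finally have "A\<^sup>2 \<le> (\<integral>\<^sup>+ z. ennreal (sqrt (d (fst z) (snd z))) * ennreal (sqrt (w z)) \<partial>\<Gamma>)\<^sup>2"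
      by (rule power_mono) simp
    also have "\<dots> \<le> (\<integral>\<^sup>+ z. (ennreal (sqrt (d (fst z) (snd z))))\<^sup>2 \<partial>\<Gamma>)
                     * (\<integral>\<^sup>+ z. (ennreal (sqrt (w z)))\<^sup>2 \<partial>\<Gamma>)"
      by (rule Cauchy_Schwarz_nn_integral) measurable
    also have "\<dots> = (\<integral>\<^sup>+ (x, y). ennreal (d x y) \<partial>\<Gamma>) * (\<integral>\<^sup>+ z. ennreal (w z) \<partial>\<Gamma>)"
      using d(2) w0 by (simp add: ennreal_power case_prod_unfold)
    also have "\<dots> \<le> (\<integral>\<^sup>+ (x, y). ennreal (d x y) \<partial>\<Gamma>) * ennreal c"
      using w_int by (rule mult_left_mono) simp
    finally show ?thesis .
  qed
  have "A\<^sup>2 / ennreal c \<le> coupling_dist d \<mu> \<nu>"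
    unfolding coupling_dist_def
  proof (rule INF_greatest)
    fix \<Gamma> assume "\<Gamma> \<in> couplings \<mu> \<nu>"
    from bound[OF this] c show "A\<^sup>2 / ennreal c \<le> (\<integral>\<^sup>+ (x, y). ennreal (d x y) \<partial>\<Gamma>)"
      by (intro divide_le_posI_ennreal) (auto simp: mult.commute)
  qed
  then have "A\<^sup>2 / ennreal c * ennreal c \<le> coupling_dist d \<mu> \<nu> * ennreal c"
    by (rule mult_right_mono) simp
  moreover have "A\<^sup>2 / ennreal c * ennreal c = A\<^sup>2"
    using c by (simp add: ennreal_divide_times ennreal_mult_divide_eq)
  ultimately show ?thesis
    by (simp add: A_def c_def)
qed

text \<open>
  The two regimes of the drift, with a common \<open>\<beta>\<close> and a common rate \<open>\<rho>\<close>. The value \<open>\<beta>\<close> is dictated by the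
  first inequality: \<open>\<theta> * (1 + \<beta> * K)\<close> has to stay below \<open>1\<close>. For the second, at the level
  \<open>4 * K / (1 - \<gamma>)\<close> the drift lowers the weight by \<open>2 * \<beta> * K\<close>, which is a fixed proportion of
  the weight there; for larger \<open>S\<close> the proportion only improves.
\<close>

lemma drift_weight_contraction:
  fixes \<gamma> \<theta> K :: real
  assumes \<gamma>: "0 < \<gamma>" "\<gamma> < 1" and \<theta>: "0 < \<theta>" "\<theta> < 1" and K: "0 < K"
  obtains \<rho> \<beta> where "0 < \<rho>" "\<rho> < 1" "0 < \<beta>"
    "\<And>S. 0 \<le> S \<Longrightarrow> \<theta> * (2 + \<beta> * (\<gamma> * S + 2 * K)) \<le> \<rho> * (2 + \<beta> * S)"
    "\<And>S. 4 * K / (1 - \<gamma>) \<le> S \<Longrightarrow> 2 + \<beta> * (\<gamma> * S + 2 * K) \<le> \<rho> * (2 + \<beta> * S)"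
proof -
  define \<kappa> where "\<kappa> = (1 - \<theta>) / 2"
  define \<beta> where "\<beta> = \<kappa> / K"
  \<comment> \<open>The relative decrease of the weight at the level \<open>4 * K / (1 - \<gamma>)\<close>.\<close>
  define \<epsilon> where "\<epsilon> = \<kappa> * (1 - \<gamma>) / (1 - \<gamma> + 2 * \<kappa>)"
  define \<rho> where "\<rho> = max ((1 + \<theta>) / 2) (1 - \<epsilon>)"
  have \<kappa>: "0 < \<kappa>" and \<beta>: "0 < \<beta>" and \<beta>K: "\<beta> * K = \<kappa>"
    using \<theta> K by (auto simp: \<kappa>_def \<beta>_def)
  have pos: "0 < 1 - \<gamma> + 2 * \<kappa>"
    using \<gamma> \<kappa> by simp
  have \<epsilon>0: "0 < \<epsilon>"
    using \<gamma> \<kappa> pos by (simp add: \<epsilon>_def)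
  have \<epsilon>_eq: "\<epsilon> * (1 - \<gamma> + 2 * \<kappa>) = \<kappa> * (1 - \<gamma>)"
    using pos by (simp add: \<epsilon>_def)
  have "\<kappa> * (1 - \<gamma>) \<le> (1 - \<gamma>) * (1 - \<gamma> + 2 * \<kappa>)"
    using \<gamma> \<kappa> by (subst mult.commute) (rule mult_left_mono, auto)
  then have \<epsilon>\<gamma>: "\<epsilon> \<le> 1 - \<gamma>"
    using pos by (simp add: \<epsilon>_def divide_le_eq)
  have \<rho>: "0 < \<rho>" "\<rho> < 1"
    using \<theta> \<epsilon>0 by (auto simp: \<rho>_def less_max_iff_disj)
  have near: "\<theta> * (2 + \<beta> * (\<gamma> * S + 2 * K)) \<le> \<rho> * (2 + \<beta> * S)" if S: "0 \<le> S" for S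
  proof -
    have "2 + \<beta> * (\<gamma> * S + 2 * K) = 2 * (1 + \<kappa>) + \<gamma> * (\<beta> * S)"
      using \<beta>K by (simp add: algebra_simps)
    also have "\<dots> \<le> 2 * (1 + \<kappa>) + (1 + \<kappa>) * (\<beta> * S)"
      using \<gamma> \<kappa> \<beta> S by (intro add_left_mono mult_right_mono) auto
    also have "\<dots> = (1 + \<kappa>) * (2 + \<beta> * S)"
      by (simp add: algebra_simps)
    finally have "\<theta> * (2 + \<beta> * (\<gamma> * S + 2 * K)) \<le> \<theta> * (1 + \<kappa>) * (2 + \<beta> * S)"
      using \<theta> by simp
    also have "\<theta> * (1 + \<kappa>) \<le> (1 + \<theta>) / 2"
      using zero_le_power2[of "1 - \<theta>"] by (simp add: \<kappa>_def power2_eq_square field_simps)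
    then have "\<theta> * (1 + \<kappa>) * (2 + \<beta> * S) \<le> \<rho> * (2 + \<beta> * S)"
      using \<beta> S by (intro mult_right_mono) (auto simp: \<rho>_def le_max_iff_disj)
    finally show ?thesis .
  qed
  have far: "2 + \<beta> * (\<gamma> * S + 2 * K) \<le> \<rho> * (2 + \<beta> * S)" if S: "4 * K / (1 - \<gamma>) \<le> S" for S
  proof -
    define T where "T = \<beta> * S"
    have "4 * \<kappa> / (1 - \<gamma>) = \<beta> * (4 * K / (1 - \<gamma>))"
      by (simp add: \<beta>K[symmetric])
    also have "\<dots> \<le> T"
      unfolding T_def using S \<beta> by (intro mult_left_mono) auto
    finally have T: "4 * \<kappa> / (1 - \<gamma>) \<le> T" .
    have "0 \<le> T"
      using T \<kappa> \<gamma> by (smt (verit) divide_nonneg_pos)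
    \<comment> \<open>The inequality for the rate \<open>1 - \<epsilon>\<close>, with all terms in \<open>T\<close> collected: since \<open>\<epsilon> \<le> 1 - \<gamma>\<close>, the worst
      \<open>T\<close> is the smallest one, and there equality holds by the choice of \<open>\<epsilon>\<close>.\<close>
    have "2 * \<epsilon> + 2 * \<kappa> = (1 - \<gamma> - \<epsilon>) * (4 * \<kappa> / (1 - \<gamma>))"
      using \<epsilon>_eq \<gamma> by (simp add: field_simps)
    also have "\<dots> \<le> (1 - \<gamma> - \<epsilon>) * T"
      using T \<epsilon>\<gamma> by (intro mult_left_mono) auto
    finally have "2 + \<gamma> * T + 2 * \<kappa> \<le> (1 - \<epsilon>) * (2 + T)"
      by (simp add: algebra_simps)
    also have "\<dots> \<le> \<rho> * (2 + T)"
      using \<open>0 \<le> T\<close> by (intro mult_right_mono) (auto simp: \<rho>_def)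
    finally show ?thesis
      using \<beta>K by (simp add: T_def algebra_simps)
  qed
  show thesis
    by (rule that[OF \<rho> \<beta>]) (use near far in auto)
qed

theorem theorem3p9:
  fixes P :: "'a::polish_space \<Rightarrow> 'a measure"
    and V :: "'a \<Rightarrow> real"
    and d :: "'a \<Rightarrow> 'a \<Rightarrow> real"
  assumes "markov_kernel P"
    and "continuous_on UNIV V"
    and "lyapunov_function P V"
    and "distance_like d"
    and "\<And>x y. d x y \<le> 1"
    and "\<exists>\<alpha>\<^sub>0. 0 < \<alpha>\<^sub>0 \<and> \<alpha>\<^sub>0 < 1 \<and>
           (\<forall>x y. d x y < 1 \<longrightarrow> coupling_dist d (P x) (P y) \<le> ennreal (\<alpha>\<^sub>0 * d x y))"
    and "\<And>R. 0 < R \<Longrightarrow> \<exists>\<alpha>. 0 < \<alpha> \<and> \<alpha> < 1 \<and>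
           (SUP (x, y) \<in> sublevel V R \<times> sublevel V R. coupling_dist d (P x) (P y))
             < ennreal (1 - \<alpha>)"
  shows "\<exists>\<alpha> \<beta>. 0 < \<alpha> \<and> \<alpha> < 1 \<and> 0 < \<beta> \<and>
           (\<forall>x y. coupling_dist (weighted_dist \<beta> V d) (P x) (P y)
                    \<le> ennreal (\<alpha> * weighted_dist \<beta> V d x y))"
proof -
  from assms(3) obtain \<gamma> K where V0: "\<And>x. 0 \<le> V x" and \<gamma>: "0 < \<gamma>" "\<gamma> < 1" and K: "0 < K"
    and drift: "\<And>x. (\<integral>\<^sup>+ y. ennreal (V y) \<partial>P x) \<le> ennreal (\<gamma> * V x + K)"
    unfolding lyapunov_function_def by blast
  from assms(4) have d0: "\<And>x y. 0 \<le> d x y" and lsc: "lower_semicontinuous (\<lambda>(x, y). d x y)"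
    unfolding distance_like_def by blast+
  have V_meas: "V \<in> borel_measurable borel"
    using assms(2) by (rule borel_measurable_continuous_onI)
  from assms(6) obtain \<alpha>\<^sub>0 where \<alpha>\<^sub>0: "0 < \<alpha>\<^sub>0" "\<alpha>\<^sub>0 < 1"
    and local: "\<And>x y. d x y < 1 \<Longrightarrow> coupling_dist d (P x) (P y) \<le> ennreal (\<alpha>\<^sub>0 * d x y)"
    by blast
  have sublevel_bound: "\<exists>\<alpha>. 0 < \<alpha> \<and> \<alpha> < 1 \<and>
      (\<forall>x y. V x < R \<longrightarrow> V y < R \<longrightarrow> coupling_dist d (P x) (P y) \<le> ennreal (1 - \<alpha>))" if R: "0 < R" for R
  proof -
    from assms(7)[OF R] obtain \<alpha> where \<alpha>: "0 < \<alpha>" "\<alpha> < 1" and sup: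
      "(SUP (x, y) \<in> sublevel V R \<times> sublevel V R. coupling_dist d (P x) (P y)) < ennreal (1 - \<alpha>)"
      by blast
    have "coupling_dist d (P x) (P y) \<le> ennreal (1 - \<alpha>)" if "V x < R" "V y < R" for x y
    proof -
      have "coupling_dist d (P x) (P y)
          \<le> (SUP (x, y) \<in> sublevel V R \<times> sublevel V R. coupling_dist d (P x) (P y))"
        using that by (intro SUP_upper2[of "(x, y)"]) (auto simp: sublevel_def)
      with sup show ?thesis by simp
    qed
    with \<alpha> show ?thesis by blast
  qed
  define L where "L = 4 * K / (1 - \<gamma>)"
  have "0 < L"
    using \<gamma> K by (simp add: L_def)
  from sublevel_bound[OF this] obtain \<alpha>\<^sub>1 where \<alpha>\<^sub>1: "0 < \<alpha>\<^sub>1" "\<alpha>\<^sub>1 < 1"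
    and small: "\<And>x y. V x < L \<Longrightarrow> V y < L \<Longrightarrow> coupling_dist d (P x) (P y) \<le> ennreal (1 - \<alpha>\<^sub>1)"
    by blast
  \<comment> \<open>Every pair lies in some sublevel set, which yields the trivial bound by \<open>1\<close>.\<close>
  have le_1: "coupling_dist d (P x) (P y) \<le> 1" for x y
  proof -
    have "0 < V x + V y + 1"
      using V0[of x] V0[of y] by simp
    from sublevel_bound[OF this] obtain \<alpha> where \<alpha>: "0 < \<alpha>"
      and *: "coupling_dist d (P x) (P y) \<le> ennreal (1 - \<alpha>)"
      using V0[of x] V0[of y] by auto
    note *
    also have "ennreal (1 - \<alpha>) \<le> ennreal 1"
      using \<alpha> by (intro ennreal_leI) simp
    finally show ?thesis by simp
  qed
  define \<theta> where "\<theta> = max \<alpha>\<^sub>0 (1 - \<alpha>\<^sub>1)"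
  have \<theta>: "0 < \<theta>" "\<theta> < 1"
    using \<alpha>\<^sub>0 \<alpha>\<^sub>1 by (auto simp: \<theta>_def)
  obtain \<rho> \<beta> where \<rho>: "0 < \<rho>" "\<rho> < 1" and \<beta>: "0 < \<beta>"
    and near: "\<And>S. 0 \<le> S \<Longrightarrow> \<theta> * (2 + \<beta> * (\<gamma> * S + 2 * K)) \<le> \<rho> * (2 + \<beta> * S)"
    and far: "\<And>S. L \<le> S \<Longrightarrow> 2 + \<beta> * (\<gamma> * S + 2 * K) \<le> \<rho> * (2 + \<beta> * S)"
    using drift_weight_contraction[OF \<gamma> \<theta> K] unfolding L_def by blast
  have "coupling_dist (weighted_dist \<beta> V d) (P x) (P y)
          \<le> ennreal (sqrt \<rho> * weighted_dist \<beta> V d x y)" for x y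
  proof -
    define S where "S = V x + V y"
    define W where "W = 2 + \<beta> * (\<gamma> * S + 2 * K)"
    have S0: "0 \<le> S" and W0: "0 \<le> W"
      using V0 \<beta> \<gamma> K by (auto simp: S_def W_def)
    have S_W: "W = 2 + \<beta> * ((\<gamma> * V x + K) + (\<gamma> * V y + K))"
      by (simp add: W_def S_def algebra_simps)
    have "\<exists>q\<ge>0. coupling_dist d (P x) (P y) \<le> ennreal q \<and> q * W \<le> \<rho> * (d x y * (2 + \<beta> * S))"
    proof -
      have contract: "\<theta> * d x y * W \<le> \<rho> * (d x y * (2 + \<beta> * S))"
        using mult_left_mono[OF near[OF S0] d0[of x y]] by (simp add: W_def mult_ac)
      consider "d x y < 1" | "d x y = 1" "S < L" | "d x y = 1" "L \<le> S"
        using assms(5)[of x y] by linarith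
      then show ?thesis
      proof cases
        case 1
        have "\<alpha>\<^sub>0 * d x y \<le> \<theta> * d x y"
          using d0[of x y] by (intro mult_right_mono) (auto simp: \<theta>_def)
        then have "coupling_dist d (P x) (P y) \<le> ennreal (\<theta> * d x y)"
          using local[OF 1] by (meson ennreal_leI order_trans)
        with contract \<theta> d0[of x y] show ?thesis by (intro exI[of _ "\<theta> * d x y"]) simp
      next
        case 2
        have "V x < L" "V y < L"
          using 2 V0[of x] V0[of y] by (auto simp: S_def)
        then have "coupling_dist d (P x) (P y) \<le> ennreal (1 - \<alpha>\<^sub>1)"
          by (rule small)
        also have "\<dots> \<le> ennreal (\<theta> * d x y)"
          using 2 by (intro ennreal_leI) (simp add: \<theta>_def)
        finally show ?thesis
          using contract \<theta> d0[of x y] by (intro exI[of _ "\<theta> * d x y"]) simp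
      next
        case 3
        then show ?thesis
          using far[of S] le_1[of x y] by (intro exI[of _ 1]) (simp add: W_def)
      qed
    qed
    then obtain q where q0: "0 \<le> q" and q: "coupling_dist d (P x) (P y) \<le> ennreal q"
      and qW: "q * W \<le> \<rho> * (d x y * (2 + \<beta> * S))"
      by blast
    have "0 \<le> \<gamma> * V x + K" "0 \<le> \<gamma> * V y + K"
      using V0 \<gamma> K by auto
    then have "(coupling_dist (weighted_dist \<beta> V d) (P x) (P y))\<^sup>2
        \<le> coupling_dist d (P x) (P y) * ennreal W"
      using coupling_dist_weighted_dist_square_le[OF lsc d0 V_meas V0 less_imp_le[OF \<beta>] _ _
          drift[of x] drift[of y]]
      by (simp add: S_W)
    also have "\<dots> \<le> ennreal q * ennreal W"
      using q by (rule mult_right_mono) simp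
    also have "\<dots> = ennreal (q * W)"
      using q0 W0 by (simp add: ennreal_mult)
    also have "\<dots> \<le> ennreal (\<rho> * (d x y * (2 + \<beta> * S)))"
      using qW by (rule ennreal_leI)
    also have "\<rho> * (d x y * (2 + \<beta> * S)) = (sqrt \<rho> * weighted_dist \<beta> V d x y)\<^sup>2"
      using \<rho> d0[of x y] S0 \<beta>
      by (simp add: weighted_dist_def power_mult_distrib S_def distrib_left add.assoc V0)
    also have "ennreal \<dots> = (ennreal (sqrt \<rho> * weighted_dist \<beta> V d x y))\<^sup>2"
      using \<rho> d0[of x y] V0 \<beta> by (simp add: ennreal_power weighted_dist_def)
    finally show ?thesis
      by (rule power2_le_imp_le_ennreal)
  qed
  moreover have "0 < sqrt \<rho>" "sqrt \<rho> < 1"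
    using \<rho> by auto
  ultimately show ?thesis
    using \<beta> by blast
qed

end
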